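(* Let $\varphi$ be a safety LTL specification with deterministic safety automaton $\mathcal{A}=(Q,q_0,\delta,\Omega)$ and universal safety controller $\mathcal{U}=(\mathcal{A},\kappa)$. Let $\mathcal{W}=(\mathcal{A},\underline{\kappa},\overline{\kappa})$ be an approximation of $\mathcal{U}$ and let $\mathcal{M}_{\mathtt{p}}=(S^{\mathtt{p}},s^{\mathtt{p}}_0,\tau^{\mathtt{p}},o^{\mathtt{p}})$ be a plant. Then the output of the procedure $\mathtt{refine}(\mathcal{W},\mathcal{M}_{\mathtt{p}})$ is a refinement of $\mathcal{W}$ with respect to $\mathcal{M}_{\mathtt{p}}$.
   Context: Atomic propositions $\mathtt{AP}=O_{\mathtt{e}}\uplus O_{\mathtt{c}}\uplus O_{\mathtt{p}}$ are partitioned into the outputs of an environment $\mathtt{e}$, a controller $\mathtt{c}$ and a plant $\mathtt{p}$; the inputs of process $i$ are $I_i=\bigcup_{j\neq i}O_j$; $\Sigma=2^{\mathtt{AP}}$. A strategy for process $i$ is a Moore machine $\mathcal{M}=(S,s_0,\tau,o)$ with finite $S$, $\tau\colon S\times 2^{I_i}\to S$, $o\colon S\to 2^{O_i}$; on inputs $\alpha_0\alpha_1\cdots$ it visits $s_0s_1\cdots$ with $s_{j+1}=\tau(s_j,\alpha_j)$ and outputs $o(s_0)o(s_1)\cdots$. $\mathit{Traces}(\mathcal{M})$ is the set of $\gamma\in\Sigma^\omega$ such that on input $(\gamma[j]\cap I_i)_j$ the machine outputs $(\gamma[j]\cap O_i)_j$; $\mathcal{M}\models\varphi$ iff all its traces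 satisfy $\varphi$. $\mathcal{M}(s)$ is the same machine with initial state $s$; $\mathit{out}(\mathcal{M},\epsilon)=o(s_0)$. $\mathbb{P}$, $\mathbb{C}$ are the sets of all plant, controller strategies. The parallel composition of $\mathcal{M}_i=(S_i,s^i_0,\tau_i,o_i)$ and $\mathcal{M}_j=(S_j,s^j_0,\tau_j,o_j)$ has states $S_i\times S_j$, initial state $(s^i_0,s^j_0)$, inputs $(I_i\cup I_j)\setminus(O_i\cup O_j)$, outputs $O_i\cup O_j$, $\tau((s,s'),\sigma)=(\tau_i(s,(\sigma\cup o_j(s'))\cap I_i),\tau_j(s',(\sigma\cup o_i(s))\cap I_j))$, $o((s,s'))=o_i(s)\cup o_j(s')$. A deterministic safety automaton $\mathcal{A}=(Q,q_0,\delta,\Omega)$ has $\delta\colon Q\times\Sigma\to Q$ and $\Omega$ the set of state sequences staying in a set $F\subseteq Q$; $\mathcal{L}(\mathcal{A})=\mathcal{L}(\varphi)$. For a Moore machine $\mathcal{M}$ with outputs $O$, the product $\mathcal{A}\times\mathcal{M}$ has states $Q\times S$, initial state $(q_0,s_0)$, partial transition $\delta'((q,s),\sigma)=(\delta(q,\sigma),\tau(s,\sigma))$ defined iff $\sigma\cap O=o(s)$. $\mathit{Runs}(\mathcal{A},q,\mathcal{M})$ is the set of runs of $\mathcal{A}$ from $q$ that are first components of runs of $\mathcal{A}\times\mathcal{M}$ from $(q,s_0)$. A prophecy controller is a pair $(\mathcal{A},\kappa)$ with $\kappa\colon Q\times 2^{O_{\mathtt{c}}}\to 2^{\mathbb{P}}$.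 A controller $\mathcal{M}_{\mathtt{c}}$ with output map $o^{\mathtt{c}}$ is consistent with $(\mathcal{A},\kappa)$ w.r.t. plant $\mathcal{M}_{\mathtt{p}}$ if for every reachable state $(q,s^{\mathtt{p}},s^{\mathtt{c}})$ of $\mathcal{A}\times(\mathcal{M}_{\mathtt{c}}\parallel\mathcal{M}_{\mathtt{p}})$, $\mathcal{M}_{\mathtt{p}}(s^{\mathtt{p}})\in\kappa(q,o^{\mathtt{c}}(s^{\mathtt{c}}))$. It is correct for $\mathcal{M}_{\mathtt{p}}$ if every consistent controller $\mathcal{M}_{\mathtt{c}}$ satisfies $\mathcal{M}_{\mathtt{p}}\parallel\mathcal{M}_{\mathtt{c}}\models\varphi$, and most permissive for $\mathcal{M}_{\mathtt{p}}$ if every $\mathcal{M}_{\mathtt{c}}$ with $\mathcal{M}_{\mathtt{p}}\parallel\mathcal{M}_{\mathtt{c}}\models\varphi$ is consistent. The universal safety controller (from prior work) is $\mathcal{U}=(\mathcal{A},\kappa)$ with $\kappa(q,\alpha)=\{\mathcal{M}_{\mathtt{p}}\in\mathbb{P}\mid\exists\mathcal{M}_{\mathtt{c}}\in\mathbb{C}.\ \mathit{out}(\mathcal{M}_{\mathtt{c}},\epsilon)=\alpha\wedge\mathit{Runs}(\mathcal{A},q,\mathcal{M}_{\mathtt{p}}\parallel\mathcal{M}_{\mathtt{c}})\subseteq\Omega\}$. An approximation of $\mathcal{U}$ is $\mathcal{W}=(\mathcal{A},\underline{\kappa},\overline{\kappa})$ with $\underline{\kappa}(q,\alpha)\subseteq\kappa(q,\alpha)\subseteq\overline{\kappa}(q,\alpha)$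 for all $q,\alpha\subseteq O_{\mathtt{c}}$. A refinement of $\mathcal{W}$ w.r.t. plant $\mathcal{M}_{\mathtt{p}}$ is a different approximation $\mathcal{W}'=(\mathcal{A},\underline{\kappa}',\overline{\kappa}')$ such that (i) $\underline{\kappa}(q,\alpha)\subseteq\underline{\kappa}'(q,\alpha)$ and $\overline{\kappa}'(q,\alpha)\subseteq\overline{\kappa}(q,\alpha)$ for all $q,\alpha$, and (ii) both $(\mathcal{A},\underline{\kappa}')$ and $(\mathcal{A},\overline{\kappa}')$ are correct and most permissive for $\mathcal{M}_{\mathtt{p}}$. The procedure $\mathtt{refine}(\mathcal{W},\mathcal{M}_{\mathtt{p}})$: form the game $G=\mathcal{A}\times\mathcal{M}_{\mathtt{p}}$ (controller chooses outputs in $O_{\mathtt{c}}$, environment chooses outputs in $O_{\mathtt{e}}$, plant outputs are determined by $o^{\mathtt{p}}$); compute the set $\mathit{Win}$ of states of $G$ from which the controller can ensure that the run stays safe (in $\Omega$); then for every $q\in Q$, $s^{\mathtt{p}}\in S^{\mathtt{p}}$ and $\alpha\subseteq O_{\mathtt{c}}$: if for every $\beta\subseteq O_{\mathtt{e}}$ the successor of $(q,s^{\mathtt{p}})$ in $G$ under controller output $\alpha$ and environment output $\beta$ lies in $\mathit{Win}$, add $\mathcal{M}_{\mathtt{p}}(s^{\mathtt{p}})$ to $\underline{\kappa}(q,\alpha)$; otherwise remove $\mathcal{M}_{\mathtt{p}}(s^{\mathtt{p}})$ from $\overline{\kappa}(q,\alpha)$. Return the updated $(\mathcal{A},\underlin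e{\kappa},\overline{\kappa})$.
   Formalization: Unsafe states of the automaton are assumed absorbing (otherwise the updated lower bound can exceed κ), and "different from W" is claimed only if some M_p(s) is still undecided, i.e. lies in the upper but not the lower bound (otherwise the procedure returns W itself). *)

theory Defs
  imports "HOL-Library.FuncSet" "HOL-Library.Disjoint_Sets"
begin

section \<open>Propositions, words, LTL\<close>

text \<open>
  The set of atomic propositions is the type \<open>'ap\<close>, a letter is a set of propositions, and
  \<open>Out i\<close> is the set of outputs of process \<open>i\<close>.  That the three sets partition \<open>'ap\<close> is an
  assumption of the theorem.
\<close>

datatype process = Env | Ctrl | Plant

type_synonym 'ap word = "nat \<Rightarrow> 'ap set"

definition In :: "(process \<Rightarrow> 'ap set) \<Rightarrow> process \<Rightarrow> 'ap set" where
  "In Out i = (\<Union>j\<in>- {i}. Out j)"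

datatype 'ap ltl =
    LTrue
  | LAtom 'ap
  | LNot "'ap ltl"
  | LAnd "'ap ltl" "'ap ltl"
  | LNext "'ap ltl"
  | LUntil "'ap ltl" "'ap ltl"

primrec ltl_sat :: "'ap word \<Rightarrow> 'ap ltl \<Rightarrow> bool" where
  "ltl_sat w LTrue = True"
| "ltl_sat w (LAtom a) = (a \<in> w 0)"
| "ltl_sat w (LNot f) = (\<not> ltl_sat w f)"
| "ltl_sat w (LAnd f g) = (ltl_sat w f \<and> ltl_sat w g)"
| "ltl_sat w (LNext f) = ltl_sat (\<lambda>n. w (n + 1)) f"
| "ltl_sat w (LUntil f g) =
     (\<exists>k. ltl_sat (\<lambda>n. w (n + k)) g \<and> (\<forall>j<k. ltl_sat (\<lambda>n. w (n + j)) f))"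

definition ltl_language :: "'ap ltl \<Rightarrow> 'ap word set" where
  "ltl_language f = {w. ltl_sat w f}"

definition safety_language :: "'ap word set \<Rightarrow> bool" where
  "safety_language L \<longleftrightarrow>
     (\<forall>w. w \<notin> L \<longrightarrow> (\<exists>n. \<forall>w'. (\<forall>i<n. w' i = w i) \<longrightarrow> w' \<notin> L))"


section \<open>Moore machines\<close>

record ('s, 'ap) moore =
  inputs :: "'ap set"
  outputs :: "'ap set"
  states :: "'s set"
  init :: 's
  step :: "'s \<Rightarrow> 'ap set \<Rightarrow> 's"
  out :: "'s \<Rightarrow> 'ap set"

text \<open>
  Transition and output maps are extensional, so that two strategies are equal exactly if they
  are equal as tuples of sets and functions on \<open>S \<times> 2\<^sup>I\<close> and \<open>S\<close>.
\<close>

definition strategies :: "(process \<Rightarrow> 'ap set) \<Rightarrow> process \<Rightarrow> ('s, 'ap) moore set" where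
  "strategies Out i =
     {M. inputs M = In Out i \<and> outputs M = Out i
       \<and> finite (states M) \<and> init M \<in> states M
       \<and> step M \<in> states M \<rightarrow>\<^sub>E (Pow (inputs M) \<rightarrow>\<^sub>E states M)
       \<and> out M \<in> states M \<rightarrow>\<^sub>E Pow (outputs M)}"

text \<open>
  The state type of plants is left polymorphic.  Controllers are quantified over inside
  definitions, which requires one fixed state type; as their state sets are finite, natural
  numbers represent all of them up to renaming of states.
\<close>

abbreviation plants :: "(process \<Rightarrow> 'ap set) \<Rightarrow> ('s, 'ap) moore set" where
  "plants Out \<equiv> strategies Out Plant"

abbreviation controllers :: "(process \<Rightarrow> 'ap set) \<Rightarrow> (nat, 'ap) moore set" where
  "controllers Out \<equiv> strategies Out Ctrl"

definition from_state :: "('s, 'ap) moore \<Rightarrow> 's \<Rightarrow> ('s, 'ap) moore" where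
  "from_state M s = M\<lparr>init := s\<rparr>"

definition initial_output :: "('s, 'ap) moore \<Rightarrow> 'ap set" where
  "initial_output M = out M (init M)"

primrec visited :: "('s, 'ap) moore \<Rightarrow> 'ap word \<Rightarrow> nat \<Rightarrow> 's" where
  "visited M w 0 = init M"
| "visited M w (Suc j) = step M (visited M w j) (w j)"

definition traces :: "('s, 'ap) moore \<Rightarrow> 'ap word set" where
  "traces M =
     {w. \<forall>j. out M (visited M (\<lambda>k. w k \<inter> inputs M) j) = w j \<inter> outputs M}"

definition satisfies :: "('s, 'ap) moore \<Rightarrow> 'ap ltl \<Rightarrow> bool" where
  "satisfies M f \<longleftrightarrow> (\<forall>w\<in>traces M. ltl_sat w f)"

definition parallel :: "('s, 'ap) moore \<Rightarrow> ('t, 'ap) moore \<Rightarrow> ('s \<times> 't, 'ap) moore"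
    (infixl "\<parallel>" 65) where
  "M \<parallel> N =
     \<lparr>inputs = (inputs M \<union> inputs N) - (outputs M \<union> outputs N),
      outputs = outputs M \<union> outputs N,
      states = states M \<times> states N,
      init = (init M, init N),
      step = (\<lambda>(s, t) \<sigma>. (step M s ((\<sigma> \<union> out N t) \<inter> inputs M),
                          step N t ((\<sigma> \<union> out M s) \<inter> inputs N))),
      out = (\<lambda>(s, t). out M s \<union> out N t)\<rparr>"


section \<open>Safety automata and products\<close>

text \<open>
  The state set of an automaton is the type \<open>'q\<close>; the theorem takes it finite, and takes the unsafe
  states to be absorbing.  The latter is needed: an unsafe state \<open>q\<close> with safe winning successors
  would pass the test of the refinement procedure, although the universal controller maps \<open>q\<close> to
  the empty set, as every run from \<open>q\<close> starts outside the safe set.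
\<close>

record ('q, 'ap) automaton =
  start :: 'q
  delta :: "'q \<Rightarrow> 'ap set \<Rightarrow> 'q"
  safe :: "'q set"

definition Omega :: "('q, 'ap) automaton \<Rightarrow> (nat \<Rightarrow> 'q) set" where
  "Omega A = {r. \<forall>n. r n \<in> safe A}"

primrec run_on :: "('q, 'ap) automaton \<Rightarrow> 'q \<Rightarrow> 'ap word \<Rightarrow> nat \<Rightarrow> 'q" where
  "run_on A q w 0 = q"
| "run_on A q w (Suc n) = delta A (run_on A q w n) (w n)"

definition automaton_language :: "('q, 'ap) automaton \<Rightarrow> 'ap word set" where
  "automaton_language A = {w. run_on A (start A) w \<in> Omega A}"

definition product_step ::
    "('q, 'ap) automaton \<Rightarrow> ('s, 'ap) moore \<Rightarrow> 'q \<times> 's \<Rightarrow> 'ap set \<Rightarrow> ('q \<times> 's) option" where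
  "product_step A M v \<sigma> =
     (case v of (q, s) \<Rightarrow>
        if \<sigma> \<inter> outputs M = out M s
        then Some (delta A q \<sigma>, step M s (\<sigma> \<inter> inputs M)) else None)"

definition product_runs ::
    "('q, 'ap) automaton \<Rightarrow> ('s, 'ap) moore \<Rightarrow> 'q \<times> 's \<Rightarrow> (nat \<Rightarrow> 'q \<times> 's) set" where
  "product_runs A M v =
     {r. r 0 = v \<and> (\<exists>w. \<forall>n. product_step A M (r n) (w n) = Some (r (Suc n)))}"

definition Runs :: "('q, 'ap) automaton \<Rightarrow> 'q \<Rightarrow> ('s, 'ap) moore \<Rightarrow> (nat \<Rightarrow> 'q) set" where
  "Runs A q M = {r. (\<exists>w. r = run_on A q w) \<and> (\<exists>\<rho>\<in>product_runs A M (q, init M). r = fst \<circ> \<rho>)}"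

definition reachable :: "('q, 'ap) automaton \<Rightarrow> ('s, 'ap) moore \<Rightarrow> ('q \<times> 's) set" where
  "reachable A M =
     {(v, v'). \<exists>\<sigma>. product_step A M v \<sigma> = Some v'}\<^sup>* `` {(start A, init M)}"


section \<open>Prophecy controllers and their approximations\<close>

text \<open>
  The second component \<open>\<kappa>\<close> of a prophecy controller; only its values at \<open>\<alpha> \<subseteq> Out Ctrl\<close> are
  meaningful.
\<close>

type_synonym ('q, 's, 'ap) prophecy = "'q \<Rightarrow> 'ap set \<Rightarrow> ('s, 'ap) moore set"

definition consistent ::
    "('q, 'ap) automaton \<Rightarrow> ('q, 's, 'ap) prophecy \<Rightarrow> ('s, 'ap) moore \<Rightarrow> (nat, 'ap) moore \<Rightarrow> bool"
    where
  "consistent A \<kappa> Mp Mc \<longleftrightarrow>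
     (\<forall>q sc sp. (q, (sc, sp)) \<in> reachable A (Mc \<parallel> Mp) \<longrightarrow>
        from_state Mp sp \<in> \<kappa> q (out Mc sc))"

definition correct_for ::
    "(process \<Rightarrow> 'ap set) \<Rightarrow> 'ap ltl \<Rightarrow> ('q, 'ap) automaton \<Rightarrow> ('q, 's, 'ap) prophecy
      \<Rightarrow> ('s, 'ap) moore \<Rightarrow> bool" where
  "correct_for Out \<phi> A \<kappa> Mp \<longleftrightarrow>
     (\<forall>Mc\<in>controllers Out. consistent A \<kappa> Mp Mc \<longrightarrow> satisfies (Mp \<parallel> Mc) \<phi>)"

definition most_permissive_for ::
    "(process \<Rightarrow> 'ap set) \<Rightarrow> 'ap ltl \<Rightarrow> ('q, 'ap) automaton \<Rightarrow> ('q, 's, 'ap) prophecy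
      \<Rightarrow> ('s, 'ap) moore \<Rightarrow> bool" where
  "most_permissive_for Out \<phi> A \<kappa> Mp \<longleftrightarrow>
     (\<forall>Mc\<in>controllers Out. satisfies (Mp \<parallel> Mc) \<phi> \<longrightarrow> consistent A \<kappa> Mp Mc)"

definition universal ::
    "(process \<Rightarrow> 'ap set) \<Rightarrow> ('q, 'ap) automaton \<Rightarrow> ('q, 's, 'ap) prophecy" where
  "universal Out A q \<alpha> =
     {Mp \<in> plants Out.
        \<exists>Mc\<in>controllers Out. initial_output Mc = \<alpha> \<and> Runs A q (Mp \<parallel> Mc) \<subseteq> Omega A}"

record ('q, 's, 'ap) approx =
  lower :: "('q, 's, 'ap) prophecy"
  upper :: "('q, 's, 'ap) prophecy"

definition approximation ::
    "(process \<Rightarrow> 'ap set) \<Rightarrow> ('q, 'ap) automaton \<Rightarrow> ('q, 's, 'ap) approx \<Rightarrow> bool" where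
  "approximation Out A W \<longleftrightarrow>
     (\<forall>q. \<forall>\<alpha>\<in>Pow (Out Ctrl).
        lower W q \<alpha> \<subseteq> universal Out A q \<alpha> \<and> universal Out A q \<alpha> \<subseteq> upper W q \<alpha>
        \<and> upper W q \<alpha> \<subseteq> plants Out)"

text \<open>
  A refinement is a weak refinement that differs from the given approximation.  The two notions
  are kept apart because an approximation may already be exact on a plant.
\<close>

definition weak_refinement ::
    "(process \<Rightarrow> 'ap set) \<Rightarrow> 'ap ltl \<Rightarrow> ('q, 'ap) automaton \<Rightarrow> ('s, 'ap) moore
      \<Rightarrow> ('q, 's, 'ap) approx \<Rightarrow> ('q, 's, 'ap) approx \<Rightarrow> bool" where
  "weak_refinement Out \<phi> A Mp W W' \<longleftrightarrow>
     approximation Out A W'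
     \<and> (\<forall>q. \<forall>\<alpha>\<in>Pow (Out Ctrl). lower W q \<alpha> \<subseteq> lower W' q \<alpha> \<and> upper W' q \<alpha> \<subseteq> upper W q \<alpha>)
     \<and> correct_for Out \<phi> A (lower W') Mp \<and> most_permissive_for Out \<phi> A (lower W') Mp
     \<and> correct_for Out \<phi> A (upper W') Mp \<and> most_permissive_for Out \<phi> A (upper W') Mp"

definition refinement ::
    "(process \<Rightarrow> 'ap set) \<Rightarrow> 'ap ltl \<Rightarrow> ('q, 'ap) automaton \<Rightarrow> ('s, 'ap) moore
      \<Rightarrow> ('q, 's, 'ap) approx \<Rightarrow> ('q, 's, 'ap) approx \<Rightarrow> bool" where
  "refinement Out \<phi> A Mp W W' \<longleftrightarrow>
     (\<exists>q. \<exists>\<alpha>\<in>Pow (Out Ctrl). lower W' q \<alpha> \<noteq> lower W q \<alpha> \<or> upper W' q \<alpha> \<noteq> upper W q \<alpha>)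
     \<and> weak_refinement Out \<phi> A Mp W W'"


section \<open>The refinement procedure\<close>

text \<open>
  The product step is always defined here, as \<open>\<alpha>\<close> and \<open>\<beta>\<close> contain no plant outputs.
\<close>

definition game_step ::
    "('q, 'ap) automaton \<Rightarrow> ('s, 'ap) moore \<Rightarrow> 'q \<times> 's \<Rightarrow> 'ap set \<Rightarrow> 'ap set \<Rightarrow> 'q \<times> 's" where
  "game_step A Mp v \<alpha> \<beta> = the (product_step A Mp v (\<alpha> \<union> \<beta> \<union> out Mp (snd v)))"

text \<open>
  The controller moves first in each round.  Its strategy \<open>f\<close> maps the past environment moves,
  which together with \<open>f\<close> determine the whole history of the play, to its next move.
\<close>

primrec play ::
    "('q, 'ap) automaton \<Rightarrow> ('s, 'ap) moore \<Rightarrow> 'q \<times> 's \<Rightarrow> ('ap set list \<Rightarrow> 'ap set) \<Rightarrow> 'ap word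
      \<Rightarrow> nat \<Rightarrow> 'q \<times> 's" where
  "play A Mp v f b 0 = v"
| "play A Mp v f b (Suc n) = game_step A Mp (play A Mp v f b n) (f (map b [0..<n])) (b n)"

definition Win ::
    "(process \<Rightarrow> 'ap set) \<Rightarrow> ('q, 'ap) automaton \<Rightarrow> ('s, 'ap) moore \<Rightarrow> ('q \<times> 's) set" where
  "Win Out A Mp =
     {v \<in> UNIV \<times> states Mp.
        \<exists>f. (\<forall>h. f h \<subseteq> Out Ctrl) \<and>
            (\<forall>b. (\<forall>n. b n \<subseteq> Out Env) \<longrightarrow> fst \<circ> play A Mp v f b \<in> Omega A)}"

definition winning_move ::
    "(process \<Rightarrow> 'ap set) \<Rightarrow> ('q, 'ap) automaton \<Rightarrow> ('s, 'ap) moore \<Rightarrow> 'q \<Rightarrow> 's \<Rightarrow> 'ap set \<Rightarrow> bool"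
    where
  "winning_move Out A Mp q s \<alpha> \<longleftrightarrow>
     (\<forall>\<beta>\<in>Pow (Out Env). game_step A Mp (q, s) \<alpha> \<beta> \<in> Win Out A Mp)"

text \<open>
  The machines \<open>from_state Mp s\<close> are pairwise different, so the loop of the procedure never
  treats the same entry twice and its result is independent of the order of iteration.
\<close>

definition refine ::
    "(process \<Rightarrow> 'ap set) \<Rightarrow> ('q, 'ap) automaton \<Rightarrow> ('q, 's, 'ap) approx \<Rightarrow> ('s, 'ap) moore
      \<Rightarrow> ('q, 's, 'ap) approx" where
  "refine Out A W Mp =
     \<lparr>lower = (\<lambda>q \<alpha>. lower W q \<alpha> \<union>
        {from_state Mp s | s. s \<in> states Mp \<and> \<alpha> \<subseteq> Out Ctrl \<and> winning_move Out A Mp q s \<alpha>}),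
      upper = (\<lambda>q \<alpha>. upper W q \<alpha> -
        {from_state Mp s | s. s \<in> states Mp \<and> \<alpha> \<subseteq> Out Ctrl \<and> \<not> winning_move Out A Mp q s \<alpha>})\<rparr>"

end

theory Submission
  imports Defs "HOL-Library.Countable_Set"
begin

text \<open>
  For a state \<open>s\<close> of the plant, the universal controller allows \<open>from_state Mp s\<close> at
  \<open>(q, \<alpha>)\<close> exactly if \<open>\<alpha>\<close> is a winning move at \<open>(q, s)\<close>: a controller that keeps all runs safe
  is simulated by a history-dependent strategy, and conversely safety games are won by memoryless
  strategies, which are finite controllers that track the game state. Hence both bounds of
  \<open>refine Out A W Mp\<close> decide \<open>from_state Mp s\<close> as the universal controller does. They are
  correct since winning moves exist only at safe states, and most permissive since every state
  reached under a controller that enforces the specification is still controlled safely by the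
  rest of that controller.
\<close>

section \<open>Traces and runs of Moore machines\<close>

lemma from_state_simps [simp]:
  "inputs (from_state M s) = inputs M" "outputs (from_state M s) = outputs M"
  "states (from_state M s) = states M" "init (from_state M s) = s"
  "step (from_state M s) = step M" "out (from_state M s) = out M"
  "from_state M (init M) = M"
  by (simp_all add: from_state_def)

lemma from_state_inject [simp]: "from_state M s = from_state M s' \<longleftrightarrow> s = s'"
  by (metis from_state_simps(4))

lemma from_state_in_strategies:
  "M \<in> strategies Out i \<Longrightarrow> s \<in> states M \<Longrightarrow> from_state M s \<in> strategies Out i"
  unfolding strategies_def by (simp only: mem_Collect_eq from_state_simps) blast

lemma parallel_simps [simp]:
  "inputs (M \<parallel> N) = (inputs M \<union> inputs N) - (outputs M \<union> outputs N)"
  "outputs (M \<parallel> N) = outputs M \<union> outputs N"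
  "states (M \<parallel> N) = states M \<times> states N"
  "init (M \<parallel> N) = (init M, init N)"
  "step (M \<parallel> N) (s, t) \<sigma> = (step M s ((\<sigma> \<union> out N t) \<inter> inputs M),
                          step N t ((\<sigma> \<union> out M s) \<inter> inputs N))"
  "out (M \<parallel> N) (s, t) = out M s \<union> out N t"
  by (simp_all add: parallel_def)

lemma from_state_parallel: "from_state (M \<parallel> N) (s, t) = from_state M s \<parallel> from_state N t"
  by (simp add: parallel_def from_state_def)

text \<open>Game strategies read finite histories, machines run on infinite words; this passes
  between the two views.\<close>

lemma foldl_step_eq_visited: "foldl (step M) (init M) (map w [0..<n]) = visited M w n"
  by (induction n) auto

lemma visited_Suc_shift:
  "visited M w (Suc n) = visited (from_state M (step M (init M) (w 0))) (\<lambda>k. w (Suc k)) n"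
  by (induction n) auto

lemma run_on_add: "run_on A q w (n + k) = run_on A (run_on A q w n) (\<lambda>i. w (n + i)) k"
  by (induction k) auto

text \<open>The product blocks exactly when the output part of a letter disagrees with the output of
  the machine. The automaton itself never blocks, so \<open>q\<close> can be arbitrary.\<close>

lemma traces_iff_product_step:
  "w \<in> traces M \<longleftrightarrow>
     (\<forall>n. product_step A M (run_on A q w n, visited M (\<lambda>k. w k \<inter> inputs M) n) (w n)
        = Some (run_on A q w (Suc n), visited M (\<lambda>k. w k \<inter> inputs M) (Suc n)))"
  by (auto simp: traces_def product_step_def split: if_splits)

lemma traces_Cons:
  assumes "a \<inter> outputs M = out M s" and "w \<in> traces (from_state M (step M s (a \<inter> inputs M)))"
  shows "case_nat a w \<in> traces (from_state M s)"
proof -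
  have "out M (visited (from_state M s) (\<lambda>k. case_nat a w k \<inter> inputs M) j)
      = case_nat a w j \<inter> outputs M" for j
  proof (cases j)
    case (Suc i)
    have "from_state (from_state M s) x = from_state M x" for x
      by (simp add: from_state_def)
    with Suc assms(2) show ?thesis
      by (simp only: visited_Suc_shift) (simp add: traces_def)
  qed (use assms(1) in auto)
  then show ?thesis by (simp add: traces_def)
qed

text \<open>The letters of a product run force both of its components, and by
  \<open>traces_iff_product_step\<close> the words that never block are the traces. Safety of runs
  thus becomes a statement about traces.\<close>

lemma Runs_eq_image_traces: "Runs A q M = run_on A q ` traces M"
proof (intro set_eqI iffI)
  fix r assume "r \<in> Runs A q M"
  then obtain \<rho> w where \<rho>: "r = fst \<circ> \<rho>" "\<rho> 0 = (q, init M)"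
    and w: "\<And>n. product_step A M (\<rho> n) (w n) = Some (\<rho> (Suc n))"
    by (auto simp: Runs_def product_runs_def)
  have \<rho>_eq: "\<rho> n = (run_on A q w n, visited M (\<lambda>k. w k \<inter> inputs M) n)" for n
  proof (induction n)
    case (Suc n)
    then show ?case
      using w[of n] by (auto simp: product_step_def split: if_splits)
  qed (use \<rho> in simp)
  have "w \<in> traces M"
    unfolding traces_iff_product_step[where A = A and q = q] using w unfolding \<rho>_eq by blast
  moreover have "r = run_on A q w"
    using \<rho> by (auto simp: \<rho>_eq)
  ultimately show "r \<in> run_on A q ` traces M" by blast
next
  fix r assume "r \<in> run_on A q ` traces M"
  then obtain w where w: "w \<in> traces M" and r: "r = run_on A q w" by blast
  define \<rho> where "\<rho> n = (run_on A q w n, visited M (\<lambda>k. w k \<inter> inputs M) n)" for n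
  have "\<rho> \<in> product_runs A M (q, init M)"
    using w traces_iff_product_step[of w M A q] by (auto simp: product_runs_def \<rho>_def)
  moreover have "r = fst \<circ> \<rho>" by (auto simp: r \<rho>_def)
  ultimately show "r \<in> Runs A q M"
    using r unfolding Runs_def by blast
qed

lemma trace_states_reachable:
  assumes "w \<in> traces M"
  shows "(run_on A (start A) w n, visited M (\<lambda>k. w k \<inter> inputs M) n) \<in> reachable A M"
proof (induction n)
  case 0
  then show ?case by (simp add: reachable_def)
next
  case (Suc n)
  with assms traces_iff_product_step[of w M A "start A"] show ?case
    unfolding reachable_def by (blast intro: rtrancl_into_rtrancl)
qed

text \<open>The letters on a path to the reachable state are prepended to \<open>w\<close>. A bad
  continuation after \<open>q\<close> would therefore show up in a trace of the whole machine. The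
  induction runs backwards along the path because \<open>traces_Cons\<close> extends traces at the
  front.\<close>

lemma reachable_trace_extension:
  assumes "(q, m) \<in> reachable A M" and "w \<in> traces (from_state M m)"
  shows "\<exists>u n. u \<in> traces M \<and> run_on A (start A) u n = q \<and> (\<lambda>k. u (n + k)) = w"
proof -
  have "\<exists>u n. u \<in> traces (from_state M (snd v)) \<and> run_on A (fst v) u n = q \<and> (\<lambda>k. u (n + k)) = w"
    if "(v, (q, m)) \<in> {(v, v'). \<exists>\<sigma>. product_step A M v \<sigma> = Some v'}\<^sup>*" for v
    using that
  proof (induction rule: converse_rtrancl_induct)
    case base
    have "run_on A (fst (q, m)) w 0 = q" "(\<lambda>k. w (0 + k)) = w" by auto
    then show ?case using assms(2) by (metis snd_conv)
  next
    case (step v z)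
    then obtain \<sigma> u n where \<sigma>: "product_step A M v \<sigma> = Some z"
      and u: "u \<in> traces (from_state M (snd z))" "run_on A (fst z) u n = q" "(\<lambda>k. u (n + k)) = w"
      by blast
    have z: "\<sigma> \<inter> outputs M = out M (snd v)" "fst z = delta A (fst v) \<sigma>"
      "snd z = step M (snd v) (\<sigma> \<inter> inputs M)"
      using \<sigma> by (auto simp: product_step_def split: prod.splits if_splits)
    have "case_nat \<sigma> u \<in> traces (from_state M (snd v))"
      using traces_Cons z u(1) by metis
    moreover have "run_on A (fst v) (case_nat \<sigma> u) (Suc n) = q"
      using run_on_add[of A "fst v" "case_nat \<sigma> u" 1 n] u(2) z(2) by simp
    moreover have "(\<lambda>k. case_nat \<sigma> u (Suc n + k)) = w"
      using u(3) by simp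
    ultimately show ?case by blast
  qed
  from this[of "(start A, init M)"] assms(1) show ?thesis
    by (auto simp: reachable_def)
qed

text \<open>Consistency is stated over \<open>Mc \<parallel> Mp\<close>, satisfaction over
  \<open>Mp \<parallel> Mc\<close>; the order of the components only permutes product
  states.\<close>

lemma product_step_parallel_swap:
  "product_step A (N \<parallel> M) (q, t, s) \<sigma>
     = map_option (apsnd prod.swap) (product_step A (M \<parallel> N) (q, s, t) \<sigma>)"
proof -
  have [simp]: "outputs N \<union> outputs M = outputs M \<union> outputs N"
    "inputs N \<union> inputs M = inputs M \<union> inputs N" "out N t \<union> out M s = out M s \<union> out N t"
    by (simp_all only: Un_commute)
  show ?thesis by (simp add: product_step_def)
qed

lemma reachable_parallel_swap:
  assumes "(q, (s, t)) \<in> reachable A (M \<parallel> N)"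
  shows "(q, (t, s)) \<in> reachable A (N \<parallel> M)"
proof -
  let ?R = "\<lambda>M. {(v, v'). \<exists>\<sigma>. product_step A M v \<sigma> = Some v'}"
  have "((start A, init N, init M), (fst v, prod.swap (snd v))) \<in> (?R (N \<parallel> M))\<^sup>*"
    if "((start A, init M, init N), v) \<in> (?R (M \<parallel> N))\<^sup>*" for v
    using that
  proof (induction rule: rtrancl_induct)
    case (step v z)
    have "((fst v, prod.swap (snd v)), (fst z, prod.swap (snd z))) \<in> ?R (N \<parallel> M)"
      using step(2) product_step_parallel_swap[of A N M "fst v" "snd (snd v)" "fst (snd v)"]
      by (cases v; cases z) auto
    with step show ?case by (meson rtrancl_into_rtrancl)
  qed simp
  from this[of "(q, s, t)"] assms show ?thesis
    by (simp add: reachable_def)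
qed

section \<open>Universal controller and winning moves\<close>

text \<open>The game for a single plant, without any approximation. Finiteness of \<open>'q\<close>
  bounds the memory of the controller extracted from a positional strategy.\<close>

locale plant_game =
  fixes Out :: "process \<Rightarrow> 'ap set"
    and A :: "('q::finite, 'ap) automaton"
    and Mp :: "('s, 'ap) moore"
  assumes disjoint: "disjoint_family Out" and cover: "(\<Union>i. Out i) = UNIV"
    and absorbing: "q \<notin> safe A \<Longrightarrow> delta A q \<sigma> \<notin> safe A"
    and plant: "Mp \<in> plants Out"
begin

section \<open>Interfaces of plant, controller and their composition\<close>

lemma Out_disjoint:
  "Out Env \<inter> Out Ctrl = {}" "Out Env \<inter> Out Plant = {}" "Out Ctrl \<inter> Out Plant = {}"
  using disjoint by (auto simp: disjoint_family_on_def)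

lemma process_UNIV: "(UNIV :: process set) = {Env, Ctrl, Plant}"
  using process.exhaust by auto

lemma Out_cover: "Out Env \<union> Out Ctrl \<union> Out Plant = UNIV"
  using cover by (auto simp: process_UNIV)

lemma In_eq:
  "In Out Plant = Out Env \<union> Out Ctrl" "In Out Ctrl = Out Env \<union> Out Plant"
proof -
  have "- {Plant} = {Env, Ctrl}" "- {Ctrl} = {Env, Plant}"
    using process_UNIV by auto
  then show "In Out Plant = Out Env \<union> Out Ctrl" "In Out Ctrl = Out Env \<union> Out Plant"
    by (auto simp: In_def)
qed

lemma plant_simps:
  "inputs Mp = Out Env \<union> Out Ctrl" "outputs Mp = Out Plant" "finite (states Mp)"
  "init Mp \<in> states Mp"
  using plant by (auto simp: strategies_def In_eq)

lemma plant_out: "s \<in> states Mp \<Longrightarrow> out Mp s \<subseteq> Out Plant"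
proof -
  assume "s \<in> states Mp"
  moreover have "out Mp \<in> states Mp \<rightarrow>\<^sub>E Pow (Out Plant)"
    using plant by (clarsimp simp: strategies_def)
  ultimately show ?thesis by (blast dest: PiE_mem)
qed

lemma plant_step: "s \<in> states Mp \<Longrightarrow> \<sigma> \<subseteq> inputs Mp \<Longrightarrow> step Mp s \<sigma> \<in> states Mp"
  using plant by (auto simp: strategies_def PiE_def Pi_def)

lemma controller_simps:
  assumes "Mc \<in> controllers Out"
  shows "inputs Mc = Out Env \<union> Out Plant" "outputs Mc = Out Ctrl" "init Mc \<in> states Mc"
  using assms by (auto simp: strategies_def In_eq)

lemma controller_out: "Mc \<in> controllers Out \<Longrightarrow> t \<in> states Mc \<Longrightarrow> out Mc t \<subseteq> Out Ctrl"
proof -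
  assume "Mc \<in> controllers Out" "t \<in> states Mc"
  moreover from this have "out Mc \<in> states Mc \<rightarrow>\<^sub>E Pow (Out Ctrl)"
    by (clarsimp simp: strategies_def)
  ultimately show ?thesis by (blast dest: PiE_mem)
qed

lemma controller_step:
  "Mc \<in> controllers Out \<Longrightarrow> t \<in> states Mc \<Longrightarrow> \<sigma> \<subseteq> inputs Mc \<Longrightarrow> step Mc t \<sigma> \<in> states Mc"
  by (auto simp: strategies_def PiE_def Pi_def)

lemma composition_interface:
  assumes "Mc \<in> controllers Out"
  shows "inputs (Mp \<parallel> Mc) = Out Env" "outputs (Mp \<parallel> Mc) = Out Plant \<union> Out Ctrl"
  using Out_disjoint by (auto simp: controller_simps[OF assms] plant_simps)

lemma composition_visited:
  assumes "Mc \<in> controllers Out" and "s \<in> states Mp"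
  shows "visited (from_state Mp s \<parallel> Mc) w n \<in> states Mp \<times> states Mc"
proof (induction n)
  case 0
  then show ?case using assms by (simp add: controller_simps)
next
  case (Suc n)
  obtain s' t' where "visited (from_state Mp s \<parallel> Mc) w n = (s', t')" by fastforce
  with Suc show ?case
    using assms by (auto intro!: plant_step controller_step)
qed

section \<open>Winning states and winning moves\<close>

lemma game_step_eq:
  assumes "s \<in> states Mp" "\<alpha> \<subseteq> Out Ctrl" "\<beta> \<subseteq> Out Env"
  shows "game_step A Mp (q, s) \<alpha> \<beta> = (delta A q (\<alpha> \<union> \<beta> \<union> out Mp s), step Mp s (\<alpha> \<union> \<beta>))"
proof -
  have "(\<alpha> \<union> \<beta> \<union> out Mp s) \<inter> outputs Mp = out Mp s" "(\<alpha> \<union> \<beta> \<union> out Mp s) \<inter> inputs Mp = \<alpha> \<union> \<beta>"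
    using assms plant_out[OF assms(1)] Out_disjoint by (auto simp: plant_simps)
  then show ?thesis by (simp add: game_step_def product_step_def)
qed

lemma game_step_states:
  assumes "s \<in> states Mp" "\<alpha> \<subseteq> Out Ctrl" "\<beta> \<subseteq> Out Env"
  shows "snd (game_step A Mp (q, s) \<alpha> \<beta>) \<in> states Mp"
  using assms by (simp add: game_step_eq) (rule plant_step, auto simp: plant_simps)

lemma Win_safe:
  assumes "(q, s) \<in> Win Out A Mp"
  shows "q \<in> safe A"
proof -
  obtain f where "\<And>b. (\<forall>n. b n \<subseteq> Out Env) \<Longrightarrow> fst \<circ> play A Mp (q, s) f b \<in> Omega A"
    using assms by (auto simp: Win_def)
  \<comment> \<open>Position 0 of any legal play is the starting state; the constantly empty
    environment word supplies one such play.\<close>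
  from this[of "\<lambda>_. {}"] have "(fst \<circ> play A Mp (q, s) f (\<lambda>_. {})) 0 \<in> safe A"
    unfolding Omega_def by blast
  then show ?thesis by simp
qed

text \<open>The test for a winning move inspects successors only. An unsafe \<open>q\<close> would
  have unsafe successors by \<open>absorbing\<close>, and these cannot lie in
  \<open>Win\<close>.\<close>

lemma winning_move_safe:
  assumes "winning_move Out A Mp q s \<alpha>" "s \<in> states Mp" "\<alpha> \<subseteq> Out Ctrl"
  shows "q \<in> safe A"
proof -
  have "game_step A Mp (q, s) \<alpha> {} \<in> Win Out A Mp"
    using assms(1) by (auto simp: winning_move_def)
  then show ?thesis
    using assms(2,3) absorbing by (auto simp: game_step_eq dest: Win_safe)
qed

text \<open>Histories list the oldest move first, so after the first round the residual strategy is
  \<open>f\<close> with \<open>\<beta>\<close> put in front of the history.\<close>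

lemma play_Cons:
  "play A Mp v f (case_nat \<beta> b) (Suc n)
     = play A Mp (game_step A Mp v (f []) \<beta>) (\<lambda>h. f (\<beta> # h)) b n"
proof (induction n)
  case (Suc n)
  then show ?case
    by (simp add: map_upt_Suc del: upt_Suc)
qed simp

text \<open>The move is \<open>f []\<close> for a winning strategy \<open>f\<close>: whatever
  \<open>\<beta>\<close> the environment answers, the residual strategy of \<open>f\<close> wins
  from the successor.\<close>

lemma Win_has_winning_move:
  assumes "(q, s) \<in> Win Out A Mp"
  shows "\<exists>\<alpha>\<subseteq>Out Ctrl. winning_move Out A Mp q s \<alpha>"
proof -
  obtain f where s: "s \<in> states Mp" and f: "\<And>h. f h \<subseteq> Out Ctrl"
    and safe: "\<And>b. (\<forall>n. b n \<subseteq> Out Env) \<Longrightarrow> fst \<circ> play A Mp (q, s) f b \<in> Omega A"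
    using assms by (auto simp: Win_def)
  have "game_step A Mp (q, s) (f []) \<beta> \<in> Win Out A Mp" if \<beta>: "\<beta> \<subseteq> Out Env" for \<beta>
  proof -
    have "fst \<circ> play A Mp (game_step A Mp (q, s) (f []) \<beta>) (\<lambda>h. f (\<beta> # h)) b \<in> Omega A"
      if "\<forall>n. b n \<subseteq> Out Env" for b
    proof -
      have "\<forall>n. case_nat \<beta> b n \<subseteq> Out Env"
        using that \<beta> by (auto split: nat.splits)
      from safe[OF this] have "\<forall>n. fst (play A Mp (q, s) f (case_nat \<beta> b) (Suc n)) \<in> safe A"
        unfolding Omega_def by (simp del: play.simps)
      then show ?thesis
        by (simp only: play_Cons) (simp add: Omega_def)
    qed
    then show ?thesis
      using f game_step_states[OF s f[of "[]"] \<beta>, of q]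
      by (auto simp: Win_def mem_Times_iff intro!: exI[of _ "\<lambda>h. f (\<beta> # h)"])
  qed
  then show ?thesis
    using f by (auto simp: winning_move_def)
qed

text \<open>The composition reads environment outputs only and is deterministic, so an environment
  history determines the state of the controller. The strategy replays the composition and plays
  what \<open>Mc\<close> outputs there.\<close>

lemma universal_imp_winning_move:
  assumes s: "s \<in> states Mp" and u: "from_state Mp s \<in> universal Out A q \<alpha>"
  shows "winning_move Out A Mp q s \<alpha>"
  unfolding winning_move_def
proof
  fix \<beta> assume "\<beta> \<in> Pow (Out Env)"
  then have \<beta>: "\<beta> \<subseteq> Out Env" by simp
  obtain Mc where Mc: "Mc \<in> controllers Out" and \<alpha>: "out Mc (init Mc) = \<alpha>"
    and runs: "Runs A q (from_state Mp s \<parallel> Mc) \<subseteq> Omega A"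
    using u by (auto simp: universal_def initial_output_def)
  define C where "C = from_state Mp s \<parallel> Mc"
  \<comment> \<open>The play considered starts in the successor of \<open>(q, s)\<close>, one round
    late; \<open>\<beta>\<close> restores the missing first move.\<close>
  define f where "f h = out Mc (snd (foldl (step C) (init C) (\<beta> # h)))" for h
  have out_visited: "out Mp (fst (visited C b n)) \<subseteq> Out Plant"
      "out Mc (snd (visited C b n)) \<subseteq> Out Ctrl" for b n
    using composition_visited[OF Mc s, of b n] plant_out controller_out[OF Mc]
    by (auto simp: C_def mem_Times_iff)
  have out_C: "out C v = out Mp (fst v) \<union> out Mc (snd v)" for v
    by (cases v) (simp add: C_def)
  have IO: "inputs C = Out Env" "outputs C = Out Plant \<union> Out Ctrl"
    using composition_interface[OF Mc] by (auto simp: C_def)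
  have f_visited: "f (map b [0..<n]) = out Mc (snd (visited C (case_nat \<beta> b) (Suc n)))" for b n
  proof -
    have "\<beta> # map b [0..<n] = map (case_nat \<beta> b) [0..<Suc n]"
      by (simp add: map_upt_Suc del: upt_Suc)
    then show ?thesis by (simp only: f_def foldl_step_eq_visited)
  qed
  \<comment> \<open>\<open>Win\<close> demands legal moves on all histories. Every list is a prefix
    of an infinite word, and the entries of \<open>h ! i\<close> beyond its length are never
    read.\<close>
  have f_Ctrl: "f h \<subseteq> Out Ctrl" for h
  proof -
    have "map (\<lambda>i. h ! i) [0..<length h] = h" by (rule map_nth)
    then show ?thesis
      using f_visited[of "\<lambda>i. h ! i" "length h"] out_visited(2) by metis
  qed
  have "fst \<circ> play A Mp (game_step A Mp (q, s) \<alpha> \<beta>) f b \<in> Omega A"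
    if b: "\<forall>n. b n \<subseteq> Out Env" for b
  proof -
    define b' where "b' = case_nat \<beta> b"
    have b': "b' n \<subseteq> Out Env" for n
      using b \<beta> by (auto simp: b'_def split: nat.splits)
    \<comment> \<open>The trace that the composition produces on the environment moves
      \<open>b'\<close>.\<close>
    define w where "w n = b' n \<union> out C (visited C b' n)" for n
    have w: "w n \<inter> inputs C = b' n" "w n \<inter> outputs C = out C (visited C b' n)" for n
      using b'[of n] out_visited[of b' n] Out_disjoint by (auto simp: w_def IO out_C)
    have trace: "w \<in> traces C" by (simp add: traces_def w)
    have visited_step: "visited C b' (Suc n)
        = (step Mp (fst (visited C b' n)) (out Mc (snd (visited C b' n)) \<union> b' n),
           step Mc (snd (visited C b' n)) (b' n \<union> out Mp (fst (visited C b' n))))" for n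
    proof -
      obtain s' t where v: "visited C b' n = (s', t)" by fastforce
      have "(b' n \<union> out Mc t) \<inter> inputs Mp = out Mc t \<union> b' n"
        "(b' n \<union> out Mp s') \<inter> inputs Mc = b' n \<union> out Mp s'"
        using b'[of n] out_visited[of b' n] v
        by (auto simp: plant_simps controller_simps[OF Mc])
      then show ?thesis by (simp add: v) (simp add: C_def)
    qed
    have play_eq: "game_step A Mp (run_on A q w n, fst (visited C b' n))
          (out Mc (snd (visited C b' n))) (b' n)
        = (run_on A q w (Suc n), fst (visited C b' (Suc n)))" for n
    proof -
      have "fst (visited C b' n) \<in> states Mp"
        using composition_visited[OF Mc s, of b' n] by (auto simp: C_def mem_Times_iff)
      moreover have "w n = out Mc (snd (visited C b' n)) \<union> b' n \<union> out Mp (fst (visited C b' n))"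
        by (auto simp: w_def out_C)
      ultimately show ?thesis
        unfolding visited_step using b'[of n] out_visited(2)[of b' n]
        by (simp add: game_step_eq)
    qed
    \<comment> \<open>The shift by one accounts for the round with \<open>\<alpha>\<close> and
      \<open>\<beta>\<close>, already over when this play starts.\<close>
    have "play A Mp (game_step A Mp (q, s) \<alpha> \<beta>) f b n
        = (run_on A q w (Suc n), fst (visited C b' (Suc n)))" for n
    proof (induction n)
      case 0
      show ?case
        using play_eq[of 0] by (simp add: \<alpha> b'_def C_def)
    next
      case (Suc n)
      show ?case
        using play_eq[of "Suc n"] Suc f_visited[of b n] by (simp add: b'_def)
    qed
    moreover have "run_on A q w \<in> Omega A"
      using runs trace by (auto simp: Runs_eq_image_traces C_def)
    ultimately show ?thesis
      by (simp add: Omega_def del: run_on.simps)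
  qed
  moreover have "\<alpha> \<subseteq> Out Ctrl"
    using \<alpha> Mc controller_out controller_simps by blast
  then have "game_step A Mp (q, s) \<alpha> \<beta> \<in> UNIV \<times> states Mp"
    using game_step_states[OF s _ \<beta>, of \<alpha> q] by (simp add: mem_Times_iff)
  ultimately show "game_step A Mp (q, s) \<alpha> \<beta> \<in> Win Out A Mp"
    using f_Ctrl by (auto simp: Win_def)
qed

lemma winning_move_imp_universal:
  assumes s: "s \<in> states Mp" and \<alpha>: "\<alpha> \<subseteq> Out Ctrl" and win: "winning_move Out A Mp q s \<alpha>"
  shows "from_state Mp s \<in> universal Out A q \<alpha>"
proof -
  \<comment> \<open>Playing \<open>\<alpha>\<close> on every visit to \<open>(q, s)\<close>, not only on the first, keeps the strategy
    memoryless; \<open>K\<close> is the invariant.\<close>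
  define K where "K = insert (q, s) (Win Out A Mp)"
  \<comment> \<open>Outside \<open>Win\<close> any legal move will do; this makes the positional
    strategy total.\<close>
  have "\<exists>a\<subseteq>Out Ctrl. (v \<in> Win Out A Mp \<longrightarrow> winning_move Out A Mp (fst v) (snd v) a)" for v
    using Win_has_winning_move[of "fst v" "snd v"] by auto
  then obtain g0 where g0: "\<And>v. g0 v \<subseteq> Out Ctrl"
      "\<And>v. v \<in> Win Out A Mp \<Longrightarrow> winning_move Out A Mp (fst v) (snd v) (g0 v)"
    by metis
  define g where "g = g0((q, s) := \<alpha>)"
  have g_Ctrl: "g v \<subseteq> Out Ctrl" for v
    using g0 \<alpha> by (simp add: g_def)
  have g_win: "game_step A Mp v (g v) \<beta> \<in> K" if "v \<in> K" "\<beta> \<subseteq> Out Env" for v \<beta>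
    using that g0(2)[of v] win by (cases v) (auto simp: K_def g_def winning_move_def split: if_splits)
  have K_safe: "fst v \<in> safe A" if "v \<in> K" for v
    using that winning_move_safe[OF win s \<alpha>] Win_safe[of "fst v" "snd v"] by (auto simp: K_def)
  have K_states: "snd v \<in> states Mp" if "v \<in> K" for v
    using that s by (auto simp: K_def Win_def)

  \<comment> \<open>\<open>V\<close> is finite and closed under legal game steps, so it can serve as
    the memory of the controller once it is encoded in the naturals.\<close>
  define V where "V = (UNIV :: 'q set) \<times> states Mp"
  have qs: "(q, s) \<in> V" using s by (simp add: V_def)
  have V: "finite V" by (simp add: V_def plant_simps)
  define enc where "enc = to_nat_on V"
  define dec where "dec = from_nat_into V"
  have dec_enc: "dec (enc v) = v" if "v \<in> V" for v
    using that V by (simp add: dec_def enc_def countable_finite)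
  \<comment> \<open>The controller simulates the game. It stores the plant state and knows its own
    move, so from its input it reads only the environment part.\<close>
  define Mc :: "(nat, 'ap) moore" where
    "Mc = \<lparr>inputs = In Out Ctrl, outputs = Out Ctrl, states = enc ` V, init = enc (q, s),
       step = (\<lambda>t\<in>enc ` V. \<lambda>\<sigma>\<in>Pow (In Out Ctrl).
                 enc (game_step A Mp (dec t) (g (dec t)) (\<sigma> \<inter> Out Env))),
       out = (\<lambda>t\<in>enc ` V. g (dec t))\<rparr>"
  have step_V: "game_step A Mp v (g v) (\<sigma> \<inter> Out Env) \<in> V" if "v \<in> V" for v \<sigma>
    using that game_step_states[of "snd v" "g v" "\<sigma> \<inter> Out Env" "fst v"] g_Ctrl
    by (cases v) (auto simp: V_def mem_Times_iff)
  have Mc: "Mc \<in> controllers Out"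
    using V qs g_Ctrl step_V by (simp add: strategies_def Mc_def dec_enc restrict_PiE_iff Pi_iff)
  have "run_on A q w \<in> Omega A" if w: "w \<in> traces (from_state Mp s \<parallel> Mc)" for w
  proof -
    define C where "C = from_state Mp s \<parallel> Mc"
    have IO: "inputs C = Out Env" "outputs C = Out Plant \<union> Out Ctrl"
      using composition_interface[OF Mc] by (auto simp: C_def)
    \<comment> \<open>Two invariants: the real game state stays in \<open>K\<close>, and the memory
      of the controller is its code.\<close>
    have "(run_on A q w n, fst (visited C (\<lambda>k. w k \<inter> inputs C) n)) \<in> K
        \<and> snd (visited C (\<lambda>k. w k \<inter> inputs C) n)
          = enc (run_on A q w n, fst (visited C (\<lambda>k. w k \<inter> inputs C) n))" for n
    proof (induction n)
      case 0
      then show ?case by (simp add: C_def K_def Mc_def)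
    next
      case (Suc n)
      define p where "p = run_on A q w n"
      obtain s' t where st: "visited C (\<lambda>k. w k \<inter> inputs C) n = (s', t)" by fastforce
      have K: "(p, s') \<in> K" and t: "t = enc (p, s')"
        using Suc by (simp_all add: st p_def)
      have s': "s' \<in> states Mp" and ps: "(p, s') \<in> V"
        using K_states[OF K] by (auto simp: V_def)
      have outMc: "out Mc t = g (p, s')"
        using ps by (simp add: Mc_def t dec_enc)
      have "out C (s', t) = w n \<inter> outputs C"
        using w st unfolding traces_def C_def[symmetric] by (metis (mono_tags, lifting) mem_Collect_eq)
      then have wn: "w n \<inter> (Out Plant \<union> Out Ctrl) = out Mp s' \<union> g (p, s')"
        by (simp add: IO outMc) (simp add: C_def outMc)
      define \<beta> where "\<beta> = w n \<inter> Out Env"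
      have \<beta>: "\<beta> \<subseteq> Out Env" by (simp add: \<beta>_def)
      have wn_eq: "w n = g (p, s') \<union> \<beta> \<union> out Mp s'"
        \<comment> \<open>Every proposition is an output of some process, so the plant, controller
          and environment parts make up the whole letter.\<close>
        using wn Out_cover unfolding \<beta>_def by blast
      have game: "game_step A Mp (p, s') (g (p, s')) \<beta>
          = (delta A p (w n), step Mp s' (g (p, s') \<union> \<beta>))"
        by (simp add: game_step_eq[OF s' g_Ctrl \<beta>] wn_eq)
      have inMp: "(\<beta> \<union> g (p, s')) \<inter> inputs Mp = g (p, s') \<union> \<beta>"
        using g_Ctrl[of "(p, s')"] \<beta> by (auto simp: plant_simps)
      have inMc: "(\<beta> \<union> out Mp s') \<inter> inputs Mc \<inter> Out Env = \<beta>"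
        using plant_out[OF s'] \<beta> Out_disjoint by (auto simp: controller_simps[OF Mc])
      have stepMc: "step Mc t ((\<beta> \<union> out Mp s') \<inter> inputs Mc)
          = enc (game_step A Mp (p, s') (g (p, s')) \<beta>)"
      proof -
        have "step Mc t \<sigma> = enc (game_step A Mp (p, s') (g (p, s')) (\<sigma> \<inter> Out Env))"
          if "\<sigma> \<subseteq> inputs Mc" for \<sigma>
          using that ps by (simp add: Mc_def t dec_enc)
        then show ?thesis by (simp add: inMc)
      qed
      have "visited C (\<lambda>k. w k \<inter> inputs C) (Suc n) = step C (s', t) \<beta>"
        unfolding visited.simps st by (simp only: IO \<beta>_def)
      also have "\<dots> = (step Mp s' (g (p, s') \<union> \<beta>), enc (game_step A Mp (p, s') (g (p, s')) \<beta>))"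
        by (simp add: C_def outMc inMp stepMc)
      finally have next_state: "visited C (\<lambda>k. w k \<inter> inputs C) (Suc n) = \<dots>" .
      show ?case
        unfolding next_state using g_win[OF K \<beta>] by (simp add: game flip: p_def)
    qed
    then show ?thesis
      using K_safe by (fastforce simp: Omega_def)
  qed
  then have "Runs A q (from_state Mp s \<parallel> Mc) \<subseteq> Omega A"
    by (auto simp: Runs_eq_image_traces)
  \<comment> \<open>If \<open>(q, s)\<close> is itself in \<open>Win\<close>, \<open>g0\<close> may
    prefer another move there; the update in \<open>g\<close> enforces
    \<open>\<alpha>\<close>.\<close>
  moreover have "initial_output Mc = \<alpha>"
    using qs by (simp add: initial_output_def Mc_def dec_enc qs g_def)
  ultimately show ?thesis
    using Mc from_state_in_strategies[OF plant s] by (auto simp: universal_def)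
qed

section \<open>Correctness and permissiveness\<close>

text \<open>Along a trace under a consistent controller, the current output is a winning move at
  every position, so every automaton state met is safe by \<open>winning_move_safe\<close>. This
  already puts the trace in the language.\<close>

lemma correct_if_winning:
  assumes lang: "automaton_language A = ltl_language \<phi>"
    and \<kappa>: "\<And>q s \<alpha>. s \<in> states Mp \<Longrightarrow> \<alpha> \<subseteq> Out Ctrl \<Longrightarrow> from_state Mp s \<in> \<kappa> q \<alpha>
      \<Longrightarrow> winning_move Out A Mp q s \<alpha>"
  shows "correct_for Out \<phi> A \<kappa> Mp"
  unfolding correct_for_def satisfies_def
proof (intro ballI impI)
  fix Mc w
  assume Mc: "Mc \<in> controllers Out" and con: "consistent A \<kappa> Mp Mc" and w: "w \<in> traces (Mp \<parallel> Mc)"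
  have "run_on A (start A) w n \<in> safe A" for n
  proof -
    define q where "q = run_on A (start A) w n"
    obtain s t where st: "visited (Mp \<parallel> Mc) (\<lambda>k. w k \<inter> inputs (Mp \<parallel> Mc)) n = (s, t)" by fastforce
    have "(s, t) \<in> states Mp \<times> states Mc"
      using composition_visited[OF Mc plant_simps(4), of "\<lambda>k. w k \<inter> inputs (Mp \<parallel> Mc)" n] st
      by simp
    moreover have "(q, (s, t)) \<in> reachable A (Mp \<parallel> Mc)"
      using trace_states_reachable[OF w, of A n] st by (simp add: q_def)
    then have "from_state Mp s \<in> \<kappa> q (out Mc t)"
      using con reachable_parallel_swap by (fastforce simp: consistent_def)
    ultimately show ?thesis
      using \<kappa> winning_move_safe controller_out[OF Mc] unfolding q_def by blast
  qed
  then have "w \<in> automaton_language A"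
    by (simp add: automaton_language_def Omega_def)
  then show "ltl_sat w \<phi>"
    by (simp add: lang ltl_language_def)
qed

text \<open>The witness required by the universal controller at a reachable state is
  \<open>Mc\<close> itself, restarted in its current state \<open>t\<close>. Its runs are safe
  because they are tails of runs of the whole composition, all of which satisfy
  \<open>\<phi>\<close>.\<close>

lemma most_permissive_if_universal:
  assumes lang: "automaton_language A = ltl_language \<phi>"
    and \<kappa>: "\<And>q s \<alpha>. s \<in> states Mp \<Longrightarrow> \<alpha> \<subseteq> Out Ctrl \<Longrightarrow> from_state Mp s \<in> universal Out A q \<alpha>
      \<Longrightarrow> from_state Mp s \<in> \<kappa> q \<alpha>"
  shows "most_permissive_for Out \<phi> A \<kappa> Mp"
  unfolding most_permissive_for_def consistent_def
proof (intro ballI impI allI)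
  fix Mc q t s
  assume Mc: "Mc \<in> controllers Out" and sat: "satisfies (Mp \<parallel> Mc) \<phi>"
    and "(q, (t, s)) \<in> reachable A (Mc \<parallel> Mp)"
  then have reach: "(q, (s, t)) \<in> reachable A (Mp \<parallel> Mc)"
    by (simp add: reachable_parallel_swap)
  \<comment> \<open>Reachability is defined by product steps alone, so membership in the state sets
    is derived along the path.\<close>
  have states: "s \<in> states Mp \<and> t \<in> states Mc"
  proof -
    have "snd v \<in> states Mp \<times> states Mc"
      if "((start A, init Mp, init Mc), v) \<in> {(v, v'). \<exists>\<sigma>. product_step A (Mp \<parallel> Mc) v \<sigma> = Some v'}\<^sup>*" for v
      using that
    proof (induction rule: rtrancl_induct)
      case base
      then show ?case using plant_simps controller_simps[OF Mc] by simp
    next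
      case (step v z)
      then show ?case
        by (cases v) (auto simp: product_step_def split: if_splits intro!: plant_step controller_step[OF Mc])
    qed
    from this[of "(q, s, t)"] reach show ?thesis by (simp add: reachable_def)
  qed
  have "run_on A q w \<in> Omega A" if "w \<in> traces (from_state Mp s \<parallel> from_state Mc t)" for w
  proof -
    have "w \<in> traces (from_state (Mp \<parallel> Mc) (s, t))"
      using that by (simp add: from_state_parallel)
    then obtain u n where u: "u \<in> traces (Mp \<parallel> Mc)" "run_on A (start A) u n = q"
        "(\<lambda>k. u (n + k)) = w"
      using reachable_trace_extension[OF reach] by blast
    have "u \<in> automaton_language A"
      using sat u(1) by (simp add: lang satisfies_def ltl_language_def)
    then have "run_on A (start A) u (n + k) \<in> safe A" for k
      by (simp add: automaton_language_def Omega_def)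
    then show ?thesis
      by (simp add: run_on_add u Omega_def)
  qed
  then have "from_state Mp s \<in> universal Out A q (out Mc t)"
    using states from_state_in_strategies[OF plant] from_state_in_strategies[OF Mc]
    by (auto simp: universal_def Runs_eq_image_traces initial_output_def
        intro!: bexI[of _ "from_state Mc t"])
  then show "from_state Mp s \<in> \<kappa> q (out Mc t)"
    using \<kappa> states controller_out[OF Mc] by blast
qed

end

theorem theorem1:
  fixes Out :: "process \<Rightarrow> 'ap set"
    and \<phi> :: "'ap ltl"
    and A :: "('q::finite, 'ap) automaton"
    and W :: "('q, 's, 'ap) approx"
    and Mp :: "('s, 'ap) moore"
  assumes "disjoint_family Out" and "(\<Union>i. Out i) = UNIV"
    and "safety_language (ltl_language \<phi>)"
    and "automaton_language A = ltl_language \<phi>"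
    and unsafe_absorbing: "\<And>q \<sigma>. q \<notin> safe A \<Longrightarrow> delta A q \<sigma> \<notin> safe A"
    and "approximation Out A W"
    and "Mp \<in> plants Out"
  shows "weak_refinement Out \<phi> A Mp W (refine Out A W Mp)
    \<and> ((\<exists>q. \<exists>s\<in>states Mp. \<exists>\<alpha>\<in>Pow (Out Ctrl). from_state Mp s \<in> upper W q \<alpha> - lower W q \<alpha>)
        \<longrightarrow> refinement Out \<phi> A Mp W (refine Out A W Mp))"
proof -
  interpret plant_game Out A Mp
    by unfold_locales (fact assms)+
  let ?W = "refine Out A W Mp"
  have universal_iff: "from_state Mp s \<in> universal Out A q \<alpha> \<longleftrightarrow> winning_move Out A Mp q s \<alpha>"
    if "s \<in> states Mp" "\<alpha> \<subseteq> Out Ctrl" for q s \<alpha>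
    using that universal_imp_winning_move winning_move_imp_universal by blast
  have W: "lower W q \<alpha> \<subseteq> universal Out A q \<alpha>" "universal Out A q \<alpha> \<subseteq> upper W q \<alpha>"
      "upper W q \<alpha> \<subseteq> plants Out" if "\<alpha> \<subseteq> Out Ctrl" for q \<alpha>
    using \<open>approximation Out A W\<close> that by (auto simp: approximation_def)
  have approx: "approximation Out A ?W"
    unfolding approximation_def
  proof (intro allI ballI conjI)
    fix q \<alpha> assume "\<alpha> \<in> Pow (Out Ctrl)"
    then have \<alpha>: "\<alpha> \<subseteq> Out Ctrl" by simp
    show "lower ?W q \<alpha> \<subseteq> universal Out A q \<alpha>"
      using W[OF \<alpha>] universal_iff by (auto simp: refine_def)
    show "universal Out A q \<alpha> \<subseteq> upper ?W q \<alpha>"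
      using W[OF \<alpha>] universal_iff by (auto simp: refine_def)
    show "upper ?W q \<alpha> \<subseteq> plants Out"
      using W(3)[OF \<alpha>, of q] by (auto simp: refine_def)
  qed
  \<comment> \<open>Old lower entries pass the test and entries passing it were in the old upper
    bound, both via \<open>universal\<close>. As \<open>from_state Mp\<close> is injective, an entry
    is affected only by the test for its own state.\<close>
  have lower_iff: "from_state Mp s \<in> lower ?W q \<alpha> \<longleftrightarrow> winning_move Out A Mp q s \<alpha>"
    and upper_iff: "from_state Mp s \<in> upper ?W q \<alpha> \<longleftrightarrow> winning_move Out A Mp q s \<alpha>"
    if "s \<in> states Mp" "\<alpha> \<subseteq> Out Ctrl" for q s \<alpha>
    using W[OF that(2), of q] universal_iff[OF that, of q] that by (auto simp: refine_def)
  note lang = \<open>automaton_language A = ltl_language \<phi>\<close>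
  have weak: "weak_refinement Out \<phi> A Mp W ?W"
    unfolding weak_refinement_def
  proof (intro conjI)
    show "\<forall>q. \<forall>\<alpha>\<in>Pow (Out Ctrl). lower W q \<alpha> \<subseteq> lower ?W q \<alpha> \<and> upper ?W q \<alpha> \<subseteq> upper W q \<alpha>"
      by (auto simp: refine_def)
    show "correct_for Out \<phi> A (lower ?W) Mp"
      by (rule correct_if_winning[OF lang]) (simp add: lower_iff)
    show "correct_for Out \<phi> A (upper ?W) Mp"
      by (rule correct_if_winning[OF lang]) (simp add: upper_iff)
    show "most_permissive_for Out \<phi> A (lower ?W) Mp"
      by (rule most_permissive_if_universal[OF lang]) (simp add: lower_iff universal_iff)
    show "most_permissive_for Out \<phi> A (upper ?W) Mp"
      by (rule most_permissive_if_universal[OF lang]) (simp add: upper_iff universal_iff)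
  qed (rule approx)
  \<comment> \<open>The old bounds disagree on \<open>from_state Mp s\<close> while the new ones
    agree, so at least one of them has changed at \<open>(q, \<alpha>)\<close>.\<close>
  moreover have "refinement Out \<phi> A Mp W ?W"
    if "s \<in> states Mp" "\<alpha> \<subseteq> Out Ctrl" "from_state Mp s \<in> upper W q \<alpha> - lower W q \<alpha>" for q s \<alpha>
    using weak that lower_iff[OF that(1,2), of q] upper_iff[OF that(1,2), of q]
    unfolding refinement_def by blast
  ultimately show ?thesis by blast
qed

end
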